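(* For any $n\ge1$, $$\theta_n=\sum_{\sigma\in S_n,\ \sigma(1)=1}M_\sigma .$$
   Context: $\Bbbk$ is a commutative ring. $\Bbbk S_n$ has basis $\{F_\sigma\}_{\sigma\in S_n}$. Weak order and $M$ basis. For $\sigma\in S_n$, $\mathrm{Inv}(\sigma)=\{(p,q):1\le p<q\le n,\ \sigma(p)>\sigma(q)\}$; $\sigma\le\tau$ iff $\mathrm{Inv}(\sigma)\subseteq\mathrm{Inv}(\tau)$. With $\mu$ the Möbius function of this partial order on $S_n$, $M_\sigma:=\sum_{\sigma\le\tau}\mu(\sigma,\tau)F_\tau$. The element $\theta_n$. For a $\Bbbk$-module $V$, $S_n$ acts on the left on $V^{\otimes n}$ by $F_\sigma\cdot v_1\cdots v_n:=v_{\sigma^{-1}(1)}\cdots v_{\sigma^{-1}(n)}$. In the tensor algebra $T(V)$ let $[\mu,\eta]:=\mu\eta-\eta\mu$. Then $\theta_n$ is the unique element of $\Bbbk S_n$ such that for every $V$ and $v_1,\dots,v_n\in V$, $$\theta_n\cdot(v_1\cdots v_n)=[\cdots[[v_1,v_2],v_3],\cdots,v_n]$$ ($n-1$ left nested commutator brackets; $\theta_1=F_{(1)}$). ($\frac1n\theta_n$ is Dynkin's idempotent when $n$ is invertible in $\Bbbk$.) *)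

theory Defs
  imports
    "HOL-Algebra.QuotRing"
    "HOL-Algebra.Algebraic_Closure_Type"
    "HOL-Combinatorics.Permutations"
    "HOL-Library.Poly_Mapping"
begin

section \<open>The weak order on permutations and its Moebius function\<close>

definition Inv :: "nat \<Rightarrow> (nat \<Rightarrow> nat) \<Rightarrow> (nat \<times> nat) set" where
  "Inv n \<sigma> = {(p, q). 1 \<le> p \<and> p < q \<and> q \<le> n \<and> \<sigma> p > \<sigma> q}"

definition weak_le :: "nat \<Rightarrow> (nat \<Rightarrow> nat) \<Rightarrow> (nat \<Rightarrow> nat) \<Rightarrow> bool" where
  "weak_le n \<sigma> \<tau> \<longleftrightarrow> Inv n \<sigma> \<subseteq> Inv n \<tau>"

definition weak_less :: "nat \<Rightarrow> (nat \<Rightarrow> nat) \<Rightarrow> (nat \<Rightarrow> nat) \<Rightarrow> bool" where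
  "weak_less n \<sigma> \<tau> \<longleftrightarrow> weak_le n \<sigma> \<tau> \<and> \<not> weak_le n \<tau> \<sigma>"

lemma finite_Inv: "finite (Inv n \<sigma>)"
  by (rule finite_subset[of _ "{..n} \<times> {..n}"]) (auto simp: Inv_def)

function weak_moebius :: "nat \<Rightarrow> (nat \<Rightarrow> nat) \<Rightarrow> (nat \<Rightarrow> nat) \<Rightarrow> int" where
  "weak_moebius n \<sigma> \<tau> =
     (if \<sigma> = \<tau> then 1
      else if weak_le n \<sigma> \<tau> then
        - (\<Sum>\<rho> \<in> {\<rho>. \<rho> permutes {1..n} \<and> weak_le n \<sigma> \<rho> \<and> weak_less n \<rho> \<tau>}. weak_moebius n \<sigma> \<rho>)
      else 0)"
  by pat_completeness auto
termination
  by (relation "measure (\<lambda>(n, \<sigma>, \<tau>). card (Inv n \<tau>))")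
     (auto simp: weak_less_def weak_le_def intro!: psubset_card_mono finite_Inv)

declare weak_moebius.simps [simp del]

section \<open>The module of the symmetric group\<close>

text \<open>
  Elements of the free module with basis \<open>S\<^sub>n\<close> are finitely supported functions. The multiple
  \<open>c F\<^sub>\<sigma>\<close> of a basis vector is \<^term>\<open>Poly_Mapping.single \<sigma> c\<close>.
\<close>

definition sym_module :: "nat \<Rightarrow> ((nat \<Rightarrow> nat) \<Rightarrow>\<^sub>0 'a::comm_ring_1) set" where
  "sym_module n = {x. \<forall>\<sigma> \<in> Poly_Mapping.keys x. \<sigma> permutes {1..n}}"

definition M_basis :: "nat \<Rightarrow> (nat \<Rightarrow> nat) \<Rightarrow> ((nat \<Rightarrow> nat) \<Rightarrow>\<^sub>0 'a::comm_ring_1)" where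
  "M_basis n \<sigma> =
     (\<Sum>\<tau> | \<tau> permutes {1..n} \<and> weak_le n \<sigma> \<tau>.
        Poly_Mapping.single \<tau> (of_int (weak_moebius n \<sigma> \<tau>)))"

section \<open>The tensor algebra of a module\<close>

datatype 'v free_word = Word "'v list"

instantiation free_word :: (type) monoid_add
begin

definition zero_free_word :: "'v free_word" where
  "zero_free_word = Word []"

fun plus_free_word :: "'v free_word \<Rightarrow> 'v free_word \<Rightarrow> 'v free_word" where
  "plus_free_word (Word u) (Word w) = Word (u @ w)"

instance
proof
  fix a b c :: "'v free_word"
  show "a + b + c = a + (b + c)" by (cases a; cases b; cases c) simp
  show "0 + a = a" by (cases a) (simp add: zero_free_word_def)
  show "a + 0 = a" by (cases a) (simp add: zero_free_word_def)
qed

end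

text \<open>
  Since addition of words is concatenation, the type \<^typ>\<open>'v free_word \<Rightarrow>\<^sub>0 'a\<close> with its
  convolution product is the free associative unital \<open>'a\<close>-algebra on the set of all elements
  of \<open>'v\<close>. The tensor algebra of a module on \<open>'v\<close> is its quotient by the two-sided
  ideal that makes the generators depend linearly on the elements of \<open>'v\<close>.
\<close>

abbreviation free_alg :: "('v free_word \<Rightarrow>\<^sub>0 'a::comm_ring_1) ring" where
  "free_alg \<equiv> ring_of_type_algebra"

definition letter :: "'v \<Rightarrow> ('v free_word \<Rightarrow>\<^sub>0 'a::comm_ring_1)" where
  "letter x = Poly_Mapping.single (Word [x]) 1"

definition scalar :: "'a::comm_ring_1 \<Rightarrow> ('v free_word \<Rightarrow>\<^sub>0 'a)" where
  "scalar c = Poly_Mapping.single 0 c"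

definition tensor_ideal ::
    "('a::comm_ring_1 \<Rightarrow> 'v::ab_group_add \<Rightarrow> 'v) \<Rightarrow> ('v free_word \<Rightarrow>\<^sub>0 'a) set" where
  "tensor_ideal scale = genideal free_alg
     ({letter (x + y) - letter x - letter y | x y. True} \<union>
      {letter (scale c x) - scalar c * letter x | c x. True})"

definition tensor_alg ::
    "('a::comm_ring_1 \<Rightarrow> 'v::ab_group_add \<Rightarrow> 'v) \<Rightarrow> ('v free_word \<Rightarrow>\<^sub>0 'a) set ring" where
  "tensor_alg scale = free_alg Quot tensor_ideal scale"

definition tensor_class ::
    "('a::comm_ring_1 \<Rightarrow> 'v::ab_group_add \<Rightarrow> 'v) \<Rightarrow> ('v free_word \<Rightarrow>\<^sub>0 'a) \<Rightarrow> ('v free_word \<Rightarrow>\<^sub>0 'a) set" where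
  "tensor_class scale f = tensor_ideal scale +>\<^bsub>free_alg\<^esub> f"

definition tensor_of_vec ::
    "('a::comm_ring_1 \<Rightarrow> 'v::ab_group_add \<Rightarrow> 'v) \<Rightarrow> 'v \<Rightarrow> ('v free_word \<Rightarrow>\<^sub>0 'a) set" where
  "tensor_of_vec scale x = tensor_class scale (letter x)"

definition tensor_smult ::
    "('a::comm_ring_1 \<Rightarrow> 'v::ab_group_add \<Rightarrow> 'v) \<Rightarrow> 'a
       \<Rightarrow> ('v free_word \<Rightarrow>\<^sub>0 'a) set \<Rightarrow> ('v free_word \<Rightarrow>\<^sub>0 'a) set" where
  "tensor_smult scale c t = tensor_class scale (scalar c) \<otimes>\<^bsub>tensor_alg scale\<^esub> t"

text \<open>The product \<open>v 1 \<otimes> \<dots> \<otimes> v n\<close>. Here and below only the values of \<open>v\<close> on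
  \<open>{1..n}\<close> matter.\<close>

definition pure_tensor ::
    "('a::comm_ring_1 \<Rightarrow> 'v::ab_group_add \<Rightarrow> 'v) \<Rightarrow> nat \<Rightarrow> (nat \<Rightarrow> 'v) \<Rightarrow> ('v free_word \<Rightarrow>\<^sub>0 'a) set" where
  "pure_tensor scale n v =
     foldl (\<lambda>t i. t \<otimes>\<^bsub>tensor_alg scale\<^esub> tensor_of_vec scale (v i)) \<one>\<^bsub>tensor_alg scale\<^esub> [1..<Suc n]"

definition commutator :: "('r, 'm) ring_scheme \<Rightarrow> 'r \<Rightarrow> 'r \<Rightarrow> 'r" where
  "commutator R x y = (x \<otimes>\<^bsub>R\<^esub> y) \<ominus>\<^bsub>R\<^esub> (y \<otimes>\<^bsub>R\<^esub> x)"

definition left_bracket ::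
    "('a::comm_ring_1 \<Rightarrow> 'v::ab_group_add \<Rightarrow> 'v) \<Rightarrow> nat \<Rightarrow> (nat \<Rightarrow> 'v) \<Rightarrow> ('v free_word \<Rightarrow>\<^sub>0 'a) set" where
  "left_bracket scale n v =
     foldl (\<lambda>t i. commutator (tensor_alg scale) t (tensor_of_vec scale (v i)))
       (tensor_of_vec scale (v 1)) [2..<Suc n]"

text \<open>
  The linear action of \<open>x = (\<Sum>\<sigma>. x\<^sub>\<sigma> F\<^sub>\<sigma>)\<close> on the pure tensor \<open>v 1 \<otimes> \<dots> \<otimes> v n\<close>,
  where \<open>F\<^sub>\<sigma>\<close> sends it to the pure tensor with \<open>i\<close>-th factor \<open>v (\<sigma>\<^sup>-\<^sup>1 i)\<close>. The result is
  multilinear in \<open>v\<close>, so this determines the action on the whole \<open>n\<close>-th tensor power.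
\<close>

definition act_pure ::
    "('a::comm_ring_1 \<Rightarrow> 'v::ab_group_add \<Rightarrow> 'v) \<Rightarrow> nat \<Rightarrow> ((nat \<Rightarrow> nat) \<Rightarrow>\<^sub>0 'a) \<Rightarrow> (nat \<Rightarrow> 'v)
       \<Rightarrow> ('v free_word \<Rightarrow>\<^sub>0 'a) set" where
  "act_pure scale n x v =
     (\<Oplus>\<^bsub>tensor_alg scale\<^esub> \<sigma> \<in> {\<sigma>. \<sigma> permutes {1..n}}.
        tensor_smult scale (Poly_Mapping.lookup x \<sigma>)
          (pure_tensor scale n (\<lambda>i. v (inv_into UNIV \<sigma> i))))"

definition acts_as_left_bracket ::
    "('a::comm_ring_1 \<Rightarrow> 'v::ab_group_add \<Rightarrow> 'v) \<Rightarrow> nat \<Rightarrow> ((nat \<Rightarrow> nat) \<Rightarrow>\<^sub>0 'a) \<Rightarrow> bool" where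
  "acts_as_left_bracket scale n x \<longleftrightarrow> (\<forall>v. act_pure scale n x v = left_bracket scale n v)"

section \<open>The element theta\<close>

text \<open>
  A definition cannot quantify over all modules on all types. The following predicate quantifies over
  all module structures on the additive group \<^typ>\<open>nat \<Rightarrow>\<^sub>0 'a\<close>. These include the free module of
  countable rank, which already determines \<open>\<theta>\<^sub>n\<close>; that the identity then holds for modules on an
  arbitrary type is a separate assertion.
\<close>

definition is_theta :: "nat \<Rightarrow> ((nat \<Rightarrow> nat) \<Rightarrow>\<^sub>0 'a::comm_ring_1) \<Rightarrow> bool" where
  "is_theta n x \<longleftrightarrow> x \<in> sym_module n \<and>
     (\<forall>scale :: 'a \<Rightarrow> (nat \<Rightarrow>\<^sub>0 'a) \<Rightarrow> (nat \<Rightarrow>\<^sub>0 'a).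
        Modules.module scale \<longrightarrow> acts_as_left_bracket scale n x)"

definition theta :: "nat \<Rightarrow> ((nat \<Rightarrow> nat) \<Rightarrow>\<^sub>0 'a::comm_ring_1)" where
  "theta n = (THE x. is_theta n x)"

end

theory Submission
  imports Defs
begin

text \<open>
  Both sides are alternating sums over the same permutations. Each step of the bracket
  \<open>[\<dots>[v\<^sub>1, v\<^sub>2], \<dots>, v\<^sub>n]\<close> puts the next letter at the right end of the word built so far, or at
  its left end with a sign. Hence the bracket is the sum over \<open>S \<subseteq> {2..n}\<close>, with sign
  \<open>(-1)\<^bsup>|S|\<^esup>\<close>, of the words that list \<open>S\<close> in decreasing order, then \<open>1\<close>, then the rest in increasing
  order. In terms of the action, the permutation attached to \<open>S\<close> is the inverse \<open>\<sigma>\<^sub>S\<close> of this word, and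
  \<open>\<theta>\<^sub>n = (\<Sum>S. (-1)\<^bsup>|S|\<^esup> F\<^bsub>\<sigma>\<^sub>S\<^esub>)\<close> has the defining property (\<open>dynkin_acts\<close>).

  In the weak order, \<open>\<sigma>\<^sub>S\<close> is easy to locate: its inversions are exactly the pairs \<open>p < q\<close> with \<open>q \<in> S\<close>
  (\<open>Inv_valley_perm\<close>). So \<open>\<sigma>\<^sub>S \<le> \<pi>\<close> holds iff every element of \<open>S\<close> is the position of a left-to-right
  minimum of \<open>\<pi>\<close>. The coefficients of \<open>\<theta>\<^sub>n\<close> at the permutations below \<open>\<pi>\<close> therefore sum to
  the alternating sum over all sets of positions, other than \<open>1\<close>, of left-to-right minima. It is \<open>1\<close> if
  there are no such positions, that is, if \<open>\<pi> 1 = 1\<close>, and \<open>0\<close> otherwise (\<open>sum_dynkin_below\<close>). Moebius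
  inversion turns this into \<open>\<theta>\<^sub>n = (\<Sum>\<sigma> | \<sigma> 1 = 1. M\<^sub>\<sigma>)\<close> (\<open>M_basis_sum_unique\<close>).

  That \<open>\<theta>\<^sub>n\<close> is determined by its action comes from the free module with basis \<open>e\<^sub>0, e\<^sub>1, \<dots>\<close>. Expanding
  every letter in the basis gives a ring homomorphism from the free algebra on the elements of this
  module to the free algebra on \<open>\<nat>\<close>. It vanishes on the ideal that defines the tensor algebra
  (\<open>tensor_ideal_free_scale\<close>), so the coefficients of an element of the module on \<open>S\<^sub>n\<close> can be read off from its
  action on \<open>e\<^sub>1 \<otimes> \<dots> \<otimes> e\<^sub>n\<close>.
\<close>

section \<open>The tensor algebra as a quotient of the free algebra\<close>

lemma ring_of_type_algebra_simps [simp]: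
  "carrier (ring_of_type_algebra :: 'r::ring_1 ring) = UNIV"
  "x \<otimes>\<^bsub>(ring_of_type_algebra :: 'r::ring_1 ring)\<^esub> y = x * y"
  "x \<oplus>\<^bsub>(ring_of_type_algebra :: 'r::ring_1 ring)\<^esub> y = x + y"
  "\<one>\<^bsub>(ring_of_type_algebra :: 'r::ring_1 ring)\<^esub> = 1"
  "\<zero>\<^bsub>(ring_of_type_algebra :: 'r::ring_1 ring)\<^esub> = 0"
  by (simp_all add: ring_of_type_algebra_def)

lemma ring_ring_of_type_algebra: "ring (ring_of_type_algebra :: 'r::ring_1 ring)"
proof -
  have "\<exists>y. x + y = 0" for x :: 'r
    using add.right_inverse by blast
  then show ?thesis
    unfolding ring_of_type_algebra_def using add.right_inverse
    by unfold_locales (auto simp: algebra_simps Units_def)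
qed

lemma finsum_ring_of_type_algebra:
  "finsum (ring_of_type_algebra :: 'r::ring_1 ring) f A = sum f A"
proof -
  interpret ring "ring_of_type_algebra :: 'r ring" by (rule ring_ring_of_type_algebra)
  show ?thesis
    by (induction A rule: infinite_finite_induct) simp_all
qed

lemma ideal_tensor_ideal: "ideal (tensor_ideal scale) free_alg"
  unfolding tensor_ideal_def
  by (rule ring.genideal_ideal[OF ring_ring_of_type_algebra]) simp

text \<open>
  Everything about the tensor algebra is transported from the free algebra along this homomorphism, so
  that the computations below take place among honest polynomials in noncommuting letters.
\<close>

lemma ring_hom_tensor_class:
  "ring_hom_ring free_alg (tensor_alg scale) (tensor_class scale)"
  using ideal.rcos_ring_hom_ring[OF ideal_tensor_ideal[of scale]]
  unfolding tensor_alg_def tensor_class_def[abs_def] .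

lemma tensor_class_mult:
  "tensor_class scale x \<otimes>\<^bsub>tensor_alg scale\<^esub> tensor_class scale y = tensor_class scale (x * y)"
  using ring_hom_mult[OF ring_hom_ring.homh[OF ring_hom_tensor_class], of x y] by simp

lemma tensor_class_one: "\<one>\<^bsub>tensor_alg scale\<^esub> = tensor_class scale 1"
  using ring_hom_one[OF ring_hom_ring.homh[OF ring_hom_tensor_class[of scale]]] by simp

lemma tensor_class_commutator:
  "commutator (tensor_alg scale) (tensor_class scale x) (tensor_class scale y) =
     tensor_class scale (x * y - y * x)"
proof -
  interpret h: ring_hom_ring free_alg "tensor_alg scale" "tensor_class scale"
    by (rule ring_hom_tensor_class)
  have cl: "tensor_class scale z \<in> carrier (tensor_alg scale)" for z
    using h.hom_closed by simp
  have "tensor_class scale (x * y) =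
      tensor_class scale (x * y - y * x) \<oplus>\<^bsub>tensor_alg scale\<^esub> tensor_class scale (y * x)"
    using h.hom_add[of "x * y - y * x" "y * x"] by simp
  then show ?thesis
    unfolding commutator_def tensor_class_mult a_minus_def
    by (simp add: h.S.a_assoc h.S.r_neg cl)
qed

lemma tensor_class_finsum:
  "(\<Oplus>\<^bsub>tensor_alg scale\<^esub> a \<in> A. tensor_class scale (f a)) = tensor_class scale (\<Sum>a\<in>A. f a)"
  using ring_hom_ring.hom_finsum[OF ring_hom_tensor_class[of scale], of f A]
  by (simp add: finsum_ring_of_type_algebra o_def)

lemma tensor_class_eq_imp_diff_mem:
  fixes scale :: "'a::comm_ring_1 \<Rightarrow> 'v::ab_group_add \<Rightarrow> 'v"
  assumes "tensor_class scale x = tensor_class scale y"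
  shows "x - y \<in> tensor_ideal scale"
proof -
  interpret I: ideal "tensor_ideal scale" free_alg by (rule ideal_tensor_ideal)
  have "x \<in> tensor_class scale x"
    unfolding tensor_class_def by (rule I.a_rcos_self) simp
  then have "x \<in> tensor_class scale y" using assms by simp
  then show ?thesis
    unfolding tensor_class_def a_r_coset_def' by auto
qed

definition word_term :: "'v list \<Rightarrow> 'a::comm_ring_1 \<Rightarrow> 'v free_word \<Rightarrow>\<^sub>0 'a" where
  "word_term w c = Poly_Mapping.single (Word w) c"

lemma word_term_mult: "word_term u a * word_term w b = word_term (u @ w) (a * b)"
  by (simp add: word_term_def mult_single)

lemma one_eq_word_term: "1 = word_term [] 1"
  by (simp add: word_term_def flip: zero_free_word_def)

lemma pure_tensor_eq:
  "pure_tensor scale n v = tensor_class scale (word_term (map v [1..<Suc n]) 1)"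
proof -
  have "foldl (\<lambda>t i. t \<otimes>\<^bsub>tensor_alg scale\<^esub> tensor_of_vec scale (v i)) (tensor_class scale (word_term u 1)) js
      = tensor_class scale (word_term (u @ map v js) 1)" for u js
    by (induction js arbitrary: u)
       (simp_all add: tensor_of_vec_def tensor_class_mult letter_def word_term_mult flip: word_term_def)
  from this[of "[]"] show ?thesis
    unfolding pure_tensor_def tensor_class_one one_eq_word_term by simp
qed

text \<open>
  The lift to the free algebra of the action on a pure tensor.
\<close>

definition act_word ::
  "nat \<Rightarrow> ((nat \<Rightarrow> nat) \<Rightarrow>\<^sub>0 'a::comm_ring_1) \<Rightarrow> (nat \<Rightarrow> 'v) \<Rightarrow> ('v free_word \<Rightarrow>\<^sub>0 'a)" where
  "act_word n x v = (\<Sum>\<sigma> | \<sigma> permutes {1..n}.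
     word_term (map (\<lambda>i. v (inv_into UNIV \<sigma> i)) [1..<Suc n]) (Poly_Mapping.lookup x \<sigma>))"

lemma act_pure_eq: "act_pure scale n x v = tensor_class scale (act_word n x v)"
proof -
  have "tensor_smult scale c (pure_tensor scale n w) =
     tensor_class scale (word_term (map w [1..<Suc n]) c)" for c w
    by (simp add: tensor_smult_def pure_tensor_eq tensor_class_mult scalar_def word_term_def
        mult_single del: upt_Suc)
  then show ?thesis
    unfolding act_pure_def act_word_def by (simp add: tensor_class_finsum del: upt_Suc)
qed

section \<open>Expansion of the left nested bracket\<close>

text \<open>
  The words that occur in the expansion of the bracket: the letters of \<open>S\<close> have been put to the left,
  so they appear in decreasing order, and the letter \<open>1\<close> is the bottom of the valley.
\<close>

definition valley_word :: "nat \<Rightarrow> nat set \<Rightarrow> nat list" where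
  "valley_word n S = rev (filter (\<lambda>i. i \<in> S) [2..<Suc n]) @ 1 # filter (\<lambda>i. i \<notin> S) [2..<Suc n]"

text \<open>
  These are the two terms of the commutator with the letter \<open>Suc n\<close>.
\<close>

lemma valley_word_Suc:
  assumes "n \<ge> 1" "S \<subseteq> {2..n}"
  shows "valley_word (Suc n) S = valley_word n S @ [Suc n]"
    and "valley_word (Suc n) (insert (Suc n) S) = Suc n # valley_word n S"
proof -
  have "Suc n \<notin> S" using assms by auto
  moreover have "filter (\<lambda>i. i = Suc n \<or> i \<in> S) [2..<Suc n] = filter (\<lambda>i. i \<in> S) [2..<Suc n]"
    "filter (\<lambda>i. i \<noteq> Suc n \<and> i \<notin> S) [2..<Suc n] = filter (\<lambda>i. i \<notin> S) [2..<Suc n]"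
    by (auto intro!: filter_cong)
  ultimately show "valley_word (Suc n) S = valley_word n S @ [Suc n]"
    "valley_word (Suc n) (insert (Suc n) S) = Suc n # valley_word n S"
    using assms(1) by (auto simp: valley_word_def upt_Suc[of 2 "Suc n"] simp del: upt_Suc)
qed

text \<open>
  The subsets of \<open>{2..Suc n}\<close> without \<open>Suc n\<close> account for the term \<open>t * l\<close> of the outermost commutator
  \<open>t * l - l * t\<close>, and those with \<open>Suc n\<close> for the term \<open>- l * t\<close>.
\<close>

lemma left_bracket_eq:
  fixes scale :: "'a::comm_ring_1 \<Rightarrow> 'v::ab_group_add \<Rightarrow> 'v"
  assumes "n \<ge> 1"
  shows "left_bracket scale n v =
    tensor_class scale (\<Sum>S\<in>Pow {2..n}. word_term (map v (valley_word n S)) ((-1) ^ card S))"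
  using assms
proof (induction n rule: dec_induct)
  case base
  show ?case
    by (simp add: left_bracket_def valley_word_def tensor_of_vec_def letter_def word_term_def)
next
  case (step n)
  let ?t = "\<lambda>S. word_term (map v (valley_word n S)) ((-1) ^ card S) :: 'v free_word \<Rightarrow>\<^sub>0 'a"
  let ?t' = "\<lambda>S. word_term (map v (valley_word (Suc n) S)) ((-1) ^ card S) :: 'v free_word \<Rightarrow>\<^sub>0 'a"
  let ?l = "letter (v (Suc n)) :: 'v free_word \<Rightarrow>\<^sub>0 'a"
  have l: "?l = word_term [v (Suc n)] 1" by (simp add: letter_def word_term_def)
  have split: "Pow {2..Suc n} = Pow {2..n} \<union> insert (Suc n) ` Pow {2..n}"
    using step.hyps by (simp add: atLeastAtMostSuc_conv Pow_insert)
  have inj: "inj_on (insert (Suc n)) (Pow {2..n})"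
    by (rule inj_onI) (metis Icc_eq_Icc PowD Suc_n_not_le_n atLeastAtMost_iff insert_ident subset_iff)
  have ins: "?t' (insert (Suc n) S) = - (?l * ?t S)" if "S \<in> Pow {2..n}" for S
  proof -
    have "card (insert (Suc n) S) = Suc (card S)"
      using that by (subst card_insert_disjoint) (auto intro: finite_subset)
    then show ?thesis
      using that step.hyps
      by (simp add: valley_word_Suc l word_term_mult) (simp add: word_term_def single_uminus)
  qed
  have "(\<Sum>S\<in>Pow {2..Suc n}. ?t' S) = (\<Sum>S\<in>Pow {2..n}. ?t' S) + (\<Sum>S\<in>Pow {2..n}. ?t' (insert (Suc n) S))"
    unfolding split by (subst sum.union_disjoint) (auto simp: sum.reindex[OF inj])
  also have "(\<Sum>S\<in>Pow {2..n}. ?t' S) = (\<Sum>S\<in>Pow {2..n}. ?t S) * ?l"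
    unfolding sum_distrib_right using step.hyps
    by (intro sum.cong) (auto simp: valley_word_Suc l word_term_mult)
  also have "(\<Sum>S\<in>Pow {2..n}. ?t' (insert (Suc n) S)) = - (?l * (\<Sum>S\<in>Pow {2..n}. ?t S))"
    unfolding sum_distrib_left sum_negf[symmetric] by (intro sum.cong) (simp_all add: ins)
  finally show ?case
    using step.hyps step.IH
    by (simp add: left_bracket_def upt_Suc[of 2 "Suc n"] tensor_of_vec_def tensor_class_commutator
         del: upt_Suc)
qed

section \<open>Valley permutations and their inversions\<close>

lemma set_valley_word: "n \<ge> 1 \<Longrightarrow> set (valley_word n S) = {1..n}"
  by (auto simp: valley_word_def)

lemma distinct_valley_word: "distinct (valley_word n S)"
  by (auto simp: valley_word_def)

lemma length_valley_word: "n \<ge> 1 \<Longrightarrow> length (valley_word n S) = n"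
  using distinct_card[OF distinct_valley_word[of n S]] by (simp add: set_valley_word)

text \<open>
  The relative order of two letters in a valley word depends only on whether the larger one is in \<open>S\<close>.
\<close>

lemma sorted_wrt_valley_word:
  "sorted_wrt (\<lambda>a b. (b < a \<longrightarrow> a \<in> S) \<and> (a < b \<longrightarrow> b \<notin> S)) (valley_word n S)"
proof -
  have "sorted_wrt (\<lambda>b a. (b < a \<longrightarrow> a \<in> S) \<and> (a < b \<longrightarrow> b \<notin> S)) (filter (\<lambda>i. i \<in> S) [2..<Suc n])"
    by (rule sorted_wrt_mono_rel[of _ "(<)"]) (auto simp: sorted_wrt_filter simp del: upt_Suc)
  moreover have "sorted_wrt (\<lambda>a b. (b < a \<longrightarrow> a \<in> S) \<and> (a < b \<longrightarrow> b \<notin> S)) (filter (\<lambda>i. i \<notin> S) [2..<Suc n])"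
    by (rule sorted_wrt_mono_rel[of _ "(<)"]) (auto simp: sorted_wrt_filter simp del: upt_Suc)
  ultimately show ?thesis
    by (auto simp: valley_word_def sorted_wrt_append sorted_wrt_rev)
qed

text \<open>
  The valley word as a permutation in one-line notation. Since \<open>F\<^sub>\<sigma>\<close> acts by placing \<open>v (\<sigma>\<^sup>-\<^sup>1 i)\<close> at
  position \<open>i\<close>, the permutation that produces the word is the inverse, which sends a letter to its position.
\<close>

definition valley_seq :: "nat \<Rightarrow> nat set \<Rightarrow> nat \<Rightarrow> nat" where
  "valley_seq n S i = (if i \<in> {1..n} then valley_word n S ! (i - 1) else i)"

definition valley_perm :: "nat \<Rightarrow> nat set \<Rightarrow> nat \<Rightarrow> nat" where
  "valley_perm n S = inv_into UNIV (valley_seq n S)"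

lemma valley_seq_permutes:
  assumes "n \<ge> 1"
  shows "valley_seq n S permutes {1..n}"
proof (rule bij_imp_permutes)
  have "bij_betw (nth (valley_word n S)) {..<n} {1..n}"
    using assms by (intro bij_betw_nth) (simp_all add: distinct_valley_word length_valley_word set_valley_word)
  moreover have "bij_betw (\<lambda>i. i - 1) {1..n} {..<n}"
    by (rule bij_betw_byWitness[of _ Suc]) auto
  ultimately have "bij_betw (nth (valley_word n S) \<circ> (\<lambda>i. i - 1)) {1..n} {1..n}"
    using bij_betw_trans by blast
  then show "bij_betw (valley_seq n S) {1..n} {1..n}"
    by (rule bij_betw_cong[THEN iffD1, rotated]) (simp add: valley_seq_def)
qed (auto simp: valley_seq_def)

lemma valley_perm_permutes: "n \<ge> 1 \<Longrightarrow> valley_perm n S permutes {1..n}"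
  unfolding valley_perm_def by (intro permutes_inv valley_seq_permutes)

lemma inv_valley_perm: "n \<ge> 1 \<Longrightarrow> inv_into UNIV (valley_perm n S) = valley_seq n S"
  unfolding valley_perm_def by (intro inv_inv_eq permutes_bij[OF valley_seq_permutes])

lemma map_inv_valley_perm:
  assumes "n \<ge> 1"
  shows "map (inv_into UNIV (valley_perm n S)) [1..<Suc n] = valley_word n S"
  by (rule nth_equalityI)
     (use assms in \<open>auto simp: inv_valley_perm length_valley_word valley_seq_def simp del: upt_Suc\<close>)

text \<open>
  An inversion of the inverse of a word is a pair of letters that stand in the wrong order, which
  happens exactly when the larger letter has been moved to the left.
\<close>

lemma Inv_valley_perm:
  assumes "n \<ge> 1"
  shows "Inv n (valley_perm n S) = {(p, q). 1 \<le> p \<and> p < q \<and> q \<le> n \<and> q \<in> S}"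
proof -
  let ?\<sigma> = "valley_perm n S"
  have perm: "?\<sigma> permutes {1..n}" using assms by (rule valley_perm_permutes)
  have word: "valley_word n S ! (?\<sigma> p - 1) = p" "?\<sigma> p \<in> {1..n}" if "p \<in> {1..n}" for p
  proof -
    show *: "?\<sigma> p \<in> {1..n}" using permutes_in_image[OF perm, of p] that by blast
    have "valley_seq n S (?\<sigma> p) = p"
      using permutes_inverses(2)[OF perm] assms by (simp add: inv_valley_perm)
    then show "valley_word n S ! (?\<sigma> p - 1) = p" using * by (simp add: valley_seq_def)
  qed
  have before: "(b < a \<longrightarrow> a \<in> S) \<and> (a < b \<longrightarrow> b \<notin> S)"
    if "a \<in> {1..n}" "b \<in> {1..n}" "?\<sigma> a < ?\<sigma> b" for a b
    using sorted_wrt_nth_less[OF sorted_wrt_valley_word[of S n], of "?\<sigma> a - 1" "?\<sigma> b - 1"]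
      word[OF that(1)] word[OF that(2)] that(3) assms by (auto simp: length_valley_word)
  have "?\<sigma> q < ?\<sigma> p \<longleftrightarrow> q \<in> S" if "1 \<le> p" "p < q" "q \<le> n" for p q
  proof -
    have "?\<sigma> p \<noteq> ?\<sigma> q" using permutes_inj[OF perm] that(2) by (auto dest: injD)
    then show ?thesis
      using before[of p q] before[of q p] that by (auto simp: neq_iff)
  qed
  then show ?thesis by (auto simp: Inv_def)
qed

section \<open>The action of the signed sum of valley permutations\<close>

text \<open>
  The explicit form of \<open>\<theta>\<^sub>n\<close>, with one term for each word in the expansion of the bracket.
\<close>

definition dynkin :: "nat \<Rightarrow> ((nat \<Rightarrow> nat) \<Rightarrow>\<^sub>0 'a::comm_ring_1)" where
  "dynkin n = (\<Sum>S\<in>Pow {2..n}. Poly_Mapping.single (valley_perm n S) ((-1) ^ card S))"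

lemma sum_lookup_dynkin:
  assumes "n \<ge> 1" "finite A"
  shows "(\<Sum>\<sigma>\<in>A. Poly_Mapping.lookup (dynkin n :: (nat \<Rightarrow> nat) \<Rightarrow>\<^sub>0 'a::comm_ring_1) \<sigma>) =
    (\<Sum>S | S \<subseteq> {2..n} \<and> valley_perm n S \<in> A. (-1) ^ card S)"
proof -
  have "(\<Sum>\<sigma>\<in>A. Poly_Mapping.lookup (dynkin n :: (nat \<Rightarrow> nat) \<Rightarrow>\<^sub>0 'a) \<sigma>) =
      (\<Sum>S\<in>Pow {2..n}. \<Sum>\<sigma>\<in>A. (-1) ^ card S when valley_perm n S = \<sigma>)"
    unfolding dynkin_def lookup_sum lookup_single by (rule sum.swap)
  also have "\<dots> = (\<Sum>S\<in>Pow {2..n}. if valley_perm n S \<in> A then (-1) ^ card S else 0)"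
    using assms(2) by (intro sum.cong) (simp_all add: when_def)
  also have "\<dots> = (\<Sum>S | S \<subseteq> {2..n} \<and> valley_perm n S \<in> A. (-1) ^ card S)"
    by (subst sum.inter_filter[symmetric]) (auto intro!: sum.cong)
  finally show ?thesis .
qed

lemma word_term_sum: "word_term w (sum f A) = (\<Sum>a\<in>A. word_term w (f a))"
  by (induction A rule: infinite_finite_induct) (simp_all add: word_term_def single_add)

lemma act_word_dynkin:
  fixes v :: "nat \<Rightarrow> 'v"
  assumes "n \<ge> 1"
  shows "act_word n (dynkin n :: (nat \<Rightarrow> nat) \<Rightarrow>\<^sub>0 'a::comm_ring_1) v =
    (\<Sum>S\<in>Pow {2..n}. word_term (map v (valley_word n S)) ((-1) ^ card S))"
proof -
  let ?w = "\<lambda>\<sigma>. map (\<lambda>i. v (inv_into UNIV \<sigma> i)) [1..<Suc n]"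
  have "act_word n (dynkin n :: (nat \<Rightarrow> nat) \<Rightarrow>\<^sub>0 'a) v =
     (\<Sum>S\<in>Pow {2..n}. \<Sum>\<sigma> | \<sigma> permutes {1..n}.
        word_term (?w \<sigma>) ((-1) ^ card S when valley_perm n S = \<sigma>))"
    unfolding act_word_def dynkin_def lookup_sum lookup_single word_term_sum by (rule sum.swap)
  also have "\<dots> = (\<Sum>S\<in>Pow {2..n}. \<Sum>\<sigma> | \<sigma> permutes {1..n}.
        if valley_perm n S = \<sigma> then word_term (?w \<sigma>) ((-1) ^ card S) else 0)"
    by (intro sum.cong) (auto simp: word_term_def)
  also have "\<dots> = (\<Sum>S\<in>Pow {2..n}. word_term (?w (valley_perm n S)) ((-1) ^ card S))"
    using valley_perm_permutes[OF assms] by (simp add: finite_permutations del: upt_Suc One_nat_def)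
  finally have "act_word n (dynkin n :: (nat \<Rightarrow> nat) \<Rightarrow>\<^sub>0 'a) v =
    (\<Sum>S\<in>Pow {2..n}. word_term (?w (valley_perm n S)) ((-1) ^ card S))" .
  moreover have "?w (valley_perm n S) = map v (valley_word n S)" for S
    unfolding map_inv_valley_perm[OF assms, symmetric] by simp
  ultimately show ?thesis by (simp only:)
qed

lemma dynkin_acts: "n \<ge> 1 \<Longrightarrow> acts_as_left_bracket scale n (dynkin n)"
  by (simp add: acts_as_left_bracket_def act_pure_eq left_bracket_eq act_word_dynkin)

lemma dynkin_in_sym_module:
  assumes n: "n \<ge> 1"
  shows "(dynkin n :: (nat \<Rightarrow> nat) \<Rightarrow>\<^sub>0 'a::comm_ring_1) \<in> sym_module n"
proof -
  have "\<sigma> permutes {1..n}" if "Poly_Mapping.lookup (dynkin n :: _ \<Rightarrow>\<^sub>0 'a) \<sigma> \<noteq> 0" for \<sigma>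
  proof -
    from that obtain S where "((-1 :: 'a) ^ card S when valley_perm n S = \<sigma>) \<noteq> 0"
      unfolding dynkin_def lookup_sum lookup_single by (rule sum.not_neutral_contains_not_neutral)
    then have "valley_perm n S = \<sigma>" by (simp add: when_def split: if_splits)
    then show ?thesis using valley_perm_permutes[OF n, of S] by simp
  qed
  then show ?thesis by (auto simp: sym_module_def in_keys_iff)
qed

section \<open>Left-to-right minima\<close>

text \<open>
  Both sides are the expansion of \<open>(1 - 1)\<^bsup>|A|\<^esup>\<close>.
\<close>

lemma sum_alternating_Pow:
  "finite A \<Longrightarrow> (\<Sum>S\<in>Pow A. (-1) ^ card S) = (if A = {} then 1 else 0 :: 'a::comm_ring_1)"
  using prod_add[of A "\<lambda>_. -1 :: 'a" "\<lambda>_. 1"] by (simp add: power_0_left)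

text \<open>
  A valley permutation lies below \<open>\<pi>\<close> iff its set consists of positions of left-to-right minima of
  \<open>\<pi>\<close>, so the sum is an alternating sum over a full power set.
\<close>

lemma sum_dynkin_below:
  assumes n: "n \<ge> 1" and \<pi>: "\<pi> permutes {1..n}"
  shows "(\<Sum>\<sigma> | \<sigma> permutes {1..n} \<and> weak_le n \<sigma> \<pi>.
       Poly_Mapping.lookup (dynkin n :: (nat \<Rightarrow> nat) \<Rightarrow>\<^sub>0 'a::comm_ring_1) \<sigma>) =
    (if \<pi> 1 = 1 then 1 else 0)"
proof -
  \<comment> \<open>The positions, other than \<open>1\<close>, of the left-to-right minima of \<open>\<pi>\<close>.\<close>
  define L where "L = {q \<in> {2..n}. \<forall>p. 1 \<le> p \<and> p < q \<longrightarrow> \<pi> q < \<pi> p}"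
  have le: "weak_le n (valley_perm n S) \<pi> \<longleftrightarrow> S \<subseteq> L" if "S \<subseteq> {2..n}" for S
    using that unfolding weak_le_def Inv_valley_perm[OF n] by (auto simp: Inv_def L_def subset_iff)
  have L_sub: "L \<subseteq> {2..n}" by (auto simp: L_def)
  have "L = {} \<longleftrightarrow> \<pi> 1 = 1"
  proof
    assume "\<pi> 1 = 1"
    have "\<not> \<pi> q < \<pi> 1" if "q \<in> {2..n}" for q
      using that \<open>\<pi> 1 = 1\<close> permutes_in_image[OF \<pi>, of q] by auto
    then show "L = {}" unfolding L_def by force
  next
    assume L: "L = {}"
    \<comment> \<open>If the value \<open>1\<close> is not at position \<open>1\<close>, its position \<open>\<pi>' 1\<close> is that of a left-to-right minimum.\<close>
    define \<pi>' where "\<pi>' = inv_into UNIV \<pi>"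
    have \<open>\<pi>' 1 \<in> {1..n}\<close> using permutes_in_image[OF permutes_inv[OF \<pi>], of 1] n by (simp add: \<pi>'_def)
    have p1: "\<pi> (\<pi>' 1) = 1" using permutes_inverses(1)[OF \<pi>] by (simp add: \<pi>'_def)
    have "\<pi> (\<pi>' 1) < \<pi> p" if "1 \<le> p" "p < \<pi>' 1" for p
    proof -
      have "\<pi> p \<in> {1..n}" using that \<open>\<pi>' 1 \<in> {1..n}\<close> permutes_in_image[OF \<pi>, of p] by auto
      moreover have "\<pi> p \<noteq> \<pi> (\<pi>' 1)" using that injD[OF permutes_inj[OF \<pi>], of p "\<pi>' 1"] by auto
      ultimately show ?thesis using p1 by auto
    qed
    then have "\<pi>' 1 \<notin> {2..n}" using L unfolding L_def by auto
    then have "\<pi>' 1 = 1" using \<open>\<pi>' 1 \<in> {1..n}\<close> by auto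
    then show "\<pi> 1 = 1" using p1 by simp
  qed
  moreover have "{S. S \<subseteq> {2..n} \<and> valley_perm n S \<in> {\<sigma>. \<sigma> permutes {1..n} \<and> weak_le n \<sigma> \<pi>}} = Pow L"
    using le valley_perm_permutes[OF n] L_sub by blast
  moreover have "finite L" using L_sub by (rule finite_subset) simp
  ultimately show ?thesis
    using n by (subst sum_lookup_dynkin) (simp_all add: finite_permutations sum_alternating_Pow)
qed

section \<open>Moebius inversion in the weak order\<close>

lemma weak_le_refl: "weak_le n \<sigma> \<sigma>"
  by (simp add: weak_le_def)

lemma weak_le_trans: "weak_le n \<rho> \<sigma> \<Longrightarrow> weak_le n \<sigma> \<tau> \<Longrightarrow> weak_le n \<rho> \<tau>"
  by (auto simp: weak_le_def)

text \<open>
  The elements of \<open>{1..n}\<close> whose value is at most \<open>\<sigma> p\<close> are mapped bijectively to \<open>{1..\<sigma> p}\<close>. This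
  recovers a permutation from the comparisons between its values, and hence from its inversions.
\<close>

lemma permutation_rank:
  assumes \<sigma>: "\<sigma> permutes {1..n}" and p: "p \<in> {1..n}"
  shows "\<sigma> p = card {q \<in> {1..n}. \<sigma> q \<le> \<sigma> p}"
proof -
  have "\<sigma> ` {q \<in> {1..n}. \<sigma> q \<le> \<sigma> p} = {1..\<sigma> p}"
  proof
    show "\<sigma> ` {q \<in> {1..n}. \<sigma> q \<le> \<sigma> p} \<subseteq> {1..\<sigma> p}"
    proof
      fix i assume "i \<in> \<sigma> ` {q \<in> {1..n}. \<sigma> q \<le> \<sigma> p}"
      then obtain q where "q \<in> {1..n}" "\<sigma> q \<le> \<sigma> p" "i = \<sigma> q" by blast
      then show "i \<in> {1..\<sigma> p}" using permutes_in_image[OF \<sigma>, of q] by auto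
    qed
    show "{1..\<sigma> p} \<subseteq> \<sigma> ` {q \<in> {1..n}. \<sigma> q \<le> \<sigma> p}"
    proof
      fix i assume i: "i \<in> {1..\<sigma> p}"
      then have "i \<in> {1..n}" using permutes_in_image[OF \<sigma>, of p] p by auto
      then obtain q where "q \<in> {1..n}" "i = \<sigma> q" using permutes_image[OF \<sigma>] by blast
      then show "i \<in> \<sigma> ` {q \<in> {1..n}. \<sigma> q \<le> \<sigma> p}" using i by auto
    qed
  qed
  then show ?thesis
    using card_image[OF inj_on_subset[OF permutes_inj[OF \<sigma>] subset_UNIV], of "{q \<in> {1..n}. \<sigma> q \<le> \<sigma> p}"]
    by simp
qed

lemma Inv_eq_imp_eq:
  assumes \<sigma>: "\<sigma> permutes {1..n}" and \<tau>: "\<tau> permutes {1..n}" and Inv: "Inv n \<sigma> = Inv n \<tau>"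
  shows "\<sigma> = \<tau>"
proof
  have less_iff: "\<sigma> q < \<sigma> p \<longleftrightarrow> \<tau> q < \<tau> p" if "p \<in> {1..n}" "q \<in> {1..n}" "p < q" for p q
  proof -
    have "(p, q) \<in> Inv n \<sigma> \<longleftrightarrow> (p, q) \<in> Inv n \<tau>" by (simp only: Inv)
    then show ?thesis using that by (simp add: Inv_def)
  qed
  have le: "\<sigma> q \<le> \<sigma> p \<longleftrightarrow> \<tau> q \<le> \<tau> p" if "p \<in> {1..n}" "q \<in> {1..n}" for p q
  proof (cases p q rule: linorder_cases)
    case less
    then have "\<sigma> q \<noteq> \<sigma> p" "\<tau> q \<noteq> \<tau> p"
      using permutes_inj[OF \<sigma>] permutes_inj[OF \<tau>] by (auto dest: injD)
    then show ?thesis using \<open>p < q\<close> that less_iff[of p q] by (auto simp: le_less)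
  next
    case greater
    then show ?thesis using less_iff[of q p] that by (simp add: not_less[symmetric])
  qed simp
  fix p
  show "\<sigma> p = \<tau> p"
  proof (cases "p \<in> {1..n}")
    case True
    have "{q \<in> {1..n}. \<sigma> q \<le> \<sigma> p} = {q \<in> {1..n}. \<tau> q \<le> \<tau> p}" using le[OF True] by blast
    then show ?thesis using permutation_rank[OF \<sigma> True] permutation_rank[OF \<tau> True] by simp
  next
    case False
    then show ?thesis using permutes_not_in[OF \<sigma>] permutes_not_in[OF \<tau>] by simp
  qed
qed

lemma weak_le_antisym:
  "\<lbrakk>\<sigma> permutes {1..n}; \<tau> permutes {1..n}; weak_le n \<sigma> \<tau>; weak_le n \<tau> \<sigma>\<rbrakk> \<Longrightarrow> \<sigma> = \<tau>"
  unfolding weak_le_def by (rule Inv_eq_imp_eq) auto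

text \<open>
  This is antisymmetry of the weak order, in the form in which sums over lower sets use it.
\<close>

lemma weak_down_set_insert:
  assumes "\<pi> permutes {1..n}"
  shows "{\<tau>. \<tau> permutes {1..n} \<and> weak_le n \<tau> \<pi>} =
      insert \<pi> {\<tau>. \<tau> permutes {1..n} \<and> weak_less n \<tau> \<pi>}"
  using assms weak_le_antisym[of _ n \<pi>] by (auto simp: weak_less_def weak_le_refl)

lemma weak_moebius_eq_0: "\<not> weak_le n \<sigma> \<tau> \<Longrightarrow> weak_moebius n \<sigma> \<tau> = 0"
  using weak_le_refl by (subst weak_moebius.simps) auto

lemma finite_permutes_Collect: "finite {\<sigma>. \<sigma> permutes {1..n} \<and> P \<sigma>}" for n :: nat
  by (rule finite_subset[OF _ finite_permutations[of "{1..n}"]]) auto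

text \<open>
  The recursion that defines the Moebius function, in closed form. It sums over the second argument;
  uniqueness of functions with prescribed sums over principal lower sets will take the place of the
  dual identity.
\<close>

lemma weak_moebius_sum:
  assumes \<pi>: "\<pi> permutes {1..n}"
  shows "(\<Sum>\<tau> | \<tau> permutes {1..n} \<and> weak_le n \<tau> \<pi>. weak_moebius n \<sigma> \<tau>) =
    (if \<sigma> = \<pi> then 1 else 0)"
proof -
  have fin: "finite {\<tau>. \<tau> permutes {1..n} \<and> P \<tau>}" for P
    by (rule finite_permutes_Collect)
  have "(\<Sum>\<tau> | \<tau> permutes {1..n} \<and> weak_le n \<tau> \<pi>. weak_moebius n \<sigma> \<tau>) =
      weak_moebius n \<sigma> \<pi> + (\<Sum>\<tau> | \<tau> permutes {1..n} \<and> weak_less n \<tau> \<pi>. weak_moebius n \<sigma> \<tau>)"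
    unfolding weak_down_set_insert[OF \<pi>] using fin by (subst sum.insert) (auto simp: weak_less_def)
  also have "(\<Sum>\<tau> | \<tau> permutes {1..n} \<and> weak_less n \<tau> \<pi>. weak_moebius n \<sigma> \<tau>) =
      (\<Sum>\<tau> | \<tau> permutes {1..n} \<and> weak_le n \<sigma> \<tau> \<and> weak_less n \<tau> \<pi>. weak_moebius n \<sigma> \<tau>)"
    using weak_moebius_eq_0 fin by (intro sum.mono_neutral_right) auto
  also have "weak_moebius n \<sigma> \<pi> + \<dots> = (if \<sigma> = \<pi> then 1 else 0)"
  proof (cases "\<sigma> = \<pi>")
    case True
    have none: "{\<tau>. \<tau> permutes {1..n} \<and> weak_le n \<sigma> \<tau> \<and> weak_less n \<tau> \<pi>} = {}"
      unfolding True by (auto simp: weak_less_def)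
    show ?thesis unfolding none using True by (simp add: weak_moebius.simps)
  next
    case False
    have none: "{\<tau>. \<tau> permutes {1..n} \<and> weak_le n \<sigma> \<tau> \<and> weak_less n \<tau> \<pi>} = {}"
      if "\<not> weak_le n \<sigma> \<pi>"
      using that weak_le_trans by (auto simp: weak_less_def)
    show ?thesis
    proof (cases "weak_le n \<sigma> \<pi>")
      case True
      then show ?thesis using \<open>\<sigma> \<noteq> \<pi>\<close> by (subst weak_moebius.simps) simp
    next
      case False
      show ?thesis unfolding none[OF False] using False weak_moebius_eq_0 \<open>\<sigma> \<noteq> \<pi>\<close> by simp
    qed
  qed
  finally show ?thesis .
qed

text \<open>
  The sums determine the values one by one, going up in the number of inversions.
\<close>

lemma weak_order_sums_unique:
  fixes f g :: "(nat \<Rightarrow> nat) \<Rightarrow> 'a::ab_group_add"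
  assumes sums: "\<And>\<pi>. \<pi> permutes {1..n} \<Longrightarrow>
      (\<Sum>\<tau> | \<tau> permutes {1..n} \<and> weak_le n \<tau> \<pi>. f \<tau>) = (\<Sum>\<tau> | \<tau> permutes {1..n} \<and> weak_le n \<tau> \<pi>. g \<tau>)"
    and "\<pi> permutes {1..n}"
  shows "f \<pi> = g \<pi>"
  using assms(2)
proof (induction "card (Inv n \<pi>)" arbitrary: \<pi> rule: less_induct)
  case less
  have fin: "finite {\<tau>. \<tau> permutes {1..n} \<and> weak_less n \<tau> \<pi>}"
    by (rule finite_permutes_Collect)
  have notin: "\<pi> \<notin> {\<tau>. \<tau> permutes {1..n} \<and> weak_less n \<tau> \<pi>}" by (simp add: weak_less_def)
  have "(\<Sum>\<tau> | \<tau> permutes {1..n} \<and> weak_less n \<tau> \<pi>. f \<tau>) = (\<Sum>\<tau> | \<tau> permutes {1..n} \<and> weak_less n \<tau> \<pi>. g \<tau>)"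
  proof (rule sum.cong)
    fix \<tau> assume "\<tau> \<in> {\<tau>. \<tau> permutes {1..n} \<and> weak_less n \<tau> \<pi>}"
    moreover from this have "card (Inv n \<tau>) < card (Inv n \<pi>)"
      by (auto simp: weak_less_def weak_le_def intro!: psubset_card_mono finite_Inv)
    ultimately show "f \<tau> = g \<tau>" using less.hyps by simp
  qed simp
  then show ?case
    using sums[OF less.prems] unfolding weak_down_set_insert[OF less.prems] sum.insert[OF fin notin]
    by simp
qed

lemma lookup_M_basis:
  "Poly_Mapping.lookup (M_basis n \<sigma> :: (nat \<Rightarrow> nat) \<Rightarrow>\<^sub>0 'a::comm_ring_1) \<tau> =
    (of_int (weak_moebius n \<sigma> \<tau>) when \<tau> permutes {1..n})"
proof -
  have fin: "finite {\<tau>. \<tau> permutes {1..n} \<and> weak_le n \<sigma> \<tau>}"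
    by (rule finite_permutes_Collect)
  show ?thesis
    unfolding M_basis_def lookup_sum lookup_single using fin weak_moebius_eq_0[of n \<sigma> \<tau>]
    by (auto simp: when_def)
qed

text \<open>
  Moebius inversion: the coefficients of the sum of the \<open>M\<^sub>\<sigma>\<close> over all \<open>\<sigma>\<close> that satisfy \<open>f\<close> also add up
  to \<open>1\<close> or \<open>0\<close> below \<open>\<pi>\<close>, according to whether \<open>f \<pi>\<close> holds, so they agree with those of \<open>x\<close>.
\<close>

lemma M_basis_sum_unique:
  fixes x :: "(nat \<Rightarrow> nat) \<Rightarrow>\<^sub>0 'a::comm_ring_1" and f :: "(nat \<Rightarrow> nat) \<Rightarrow> bool"
  assumes x: "x \<in> sym_module n"
    and sums: "\<And>\<pi>. \<pi> permutes {1..n} \<Longrightarrow>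
      (\<Sum>\<tau> | \<tau> permutes {1..n} \<and> weak_le n \<tau> \<pi>. Poly_Mapping.lookup x \<tau>) = (if f \<pi> then 1 else 0)"
  shows "x = (\<Sum>\<sigma> | \<sigma> permutes {1..n} \<and> f \<sigma>. M_basis n \<sigma>)"
proof (rule poly_mapping_eqI)
  fix \<tau>
  let ?F = "{\<sigma>. \<sigma> permutes {1..n} \<and> f \<sigma>}"
  have fin: "finite ?F"
    by (rule finite_permutes_Collect)
  have lookup: "Poly_Mapping.lookup (\<Sum>\<sigma>\<in>?F. M_basis n \<sigma> :: (nat \<Rightarrow> nat) \<Rightarrow>\<^sub>0 'a) \<tau> =
      ((\<Sum>\<sigma>\<in>?F. of_int (weak_moebius n \<sigma> \<tau>)) when \<tau> permutes {1..n})" for \<tau>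
    unfolding lookup_sum by (simp add: lookup_M_basis when_def)
  show "Poly_Mapping.lookup x \<tau> = Poly_Mapping.lookup (\<Sum>\<sigma>\<in>?F. M_basis n \<sigma>) \<tau>"
  proof (cases "\<tau> permutes {1..n}")
    case False
    then show ?thesis using x unfolding lookup by (auto simp: sym_module_def in_keys_iff)
  next
    case True
    have "Poly_Mapping.lookup x \<tau> = (\<Sum>\<sigma>\<in>?F. of_int (weak_moebius n \<sigma> \<tau>))"
    proof (rule weak_order_sums_unique[OF _ True])
      fix \<pi> assume \<pi>: "\<pi> permutes {1..n}"
      let ?D = "{\<tau>. \<tau> permutes {1..n} \<and> weak_le n \<tau> \<pi>}"
      have "(\<Sum>\<tau>\<in>?D. \<Sum>\<sigma>\<in>?F. of_int (weak_moebius n \<sigma> \<tau>)) =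
          (\<Sum>\<sigma>\<in>?F. of_int (\<Sum>\<tau>\<in>?D. weak_moebius n \<sigma> \<tau>) :: 'a)"
        by (subst sum.swap) simp
      also have "\<dots> = (\<Sum>\<sigma>\<in>?F. if \<sigma> = \<pi> then 1 else 0)"
        by (intro sum.cong refl) (subst weak_moebius_sum[OF \<pi>], auto)
      also have "\<dots> = (if f \<pi> then 1 else 0)"
        using fin \<pi> by simp
      finally show "(\<Sum>\<tau>\<in>?D. Poly_Mapping.lookup x \<tau>) =
          (\<Sum>\<tau>\<in>?D. \<Sum>\<sigma>\<in>?F. of_int (weak_moebius n \<sigma> \<tau>))"
        using sums[OF \<pi>] by simp
    qed
    then show ?thesis using True unfolding lookup by simp
  qed
qed

section \<open>Expansion in a basis and uniqueness of theta\<close>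

text \<open>
  The linear map with prescribed values on the basis elements. The target is a monoid algebra whose
  scalars are embedded as the multiples of the unit monomial. It is used twice: to expand a vector as a
  combination of letters, and to extend a map on words to the free algebra.
\<close>

definition linear_extension ::
    "('k \<Rightarrow> ('m::monoid_add \<Rightarrow>\<^sub>0 'a::comm_ring_1)) \<Rightarrow> ('k \<Rightarrow>\<^sub>0 'a) \<Rightarrow> ('m \<Rightarrow>\<^sub>0 'a)" where
  "linear_extension f x = (\<Sum>k\<in>Poly_Mapping.keys x. Poly_Mapping.single 0 (Poly_Mapping.lookup x k) * f k)"

lemma linear_extension_superset:
  assumes "finite K" "Poly_Mapping.keys x \<subseteq> K"
  shows "linear_extension f x = (\<Sum>k\<in>K. Poly_Mapping.single 0 (Poly_Mapping.lookup x k) * f k)"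
  unfolding linear_extension_def using assms
  by (intro sum.mono_neutral_left) (auto simp: in_keys_iff)

lemma linear_extension_single [simp]:
  "linear_extension f (Poly_Mapping.single k c) = Poly_Mapping.single 0 c * f k"
  by (subst linear_extension_superset[of "{k}"]) simp_all

lemma linear_extension_add: "linear_extension f (x + y) = linear_extension f x + linear_extension f y"
proof -
  let ?K = "Poly_Mapping.keys x \<union> Poly_Mapping.keys y"
  show ?thesis
    using keys_add[of x y]
    by (simp add: linear_extension_superset[of ?K] lookup_add single_add distrib_right sum.distrib)
qed

lemma linear_extension_zero: "linear_extension f 0 = 0"
  by (simp add: linear_extension_def)

lemma linear_extension_sum: "linear_extension f (sum g A) = (\<Sum>a\<in>A. linear_extension f (g a))"
  by (induction A rule: infinite_finite_induct)
     (simp_all add: linear_extension_add linear_extension_zero)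

lemma linear_extension_diff: "linear_extension f (x - y) = linear_extension f x - linear_extension f y"
  using linear_extension_add[of f "x - y" y] by simp

lemma linear_extension_scale:
  "linear_extension f (Poly_Mapping.map ((*) c) x) = Poly_Mapping.single 0 c * linear_extension f x"
proof -
  have l: "Poly_Mapping.lookup (Poly_Mapping.map ((*) c) x) k = c * Poly_Mapping.lookup x k" for k
    by (simp add: map.rep_eq when_def)
  have "Poly_Mapping.keys (Poly_Mapping.map ((*) c) x) \<subseteq> Poly_Mapping.keys x"
    by (auto simp: in_keys_iff l)
  then show ?thesis
    by (simp add: linear_extension_superset[of "Poly_Mapping.keys x"] l sum_distrib_left mult_single
        flip: mult.assoc)
qed

lemma sum_single_lookup:
  "(\<Sum>k\<in>Poly_Mapping.keys x. Poly_Mapping.single k (Poly_Mapping.lookup x k)) = x"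
  by (rule poly_mapping_eqI) (auto simp: lookup_sum lookup_single when_def in_keys_iff)

lemma single_zero_commute:
  "Poly_Mapping.single 0 c * x = x * (Poly_Mapping.single 0 c :: 'm::monoid_add \<Rightarrow>\<^sub>0 'a::comm_ring_1)"
proof -
  have "Poly_Mapping.single 0 c * (\<Sum>k\<in>Poly_Mapping.keys x. Poly_Mapping.single k (Poly_Mapping.lookup x k)) =
      (\<Sum>k\<in>Poly_Mapping.keys x. Poly_Mapping.single k (Poly_Mapping.lookup x k)) * Poly_Mapping.single 0 c"
    unfolding sum_distrib_left sum_distrib_right by (simp add: mult_single mult.commute)
  then show ?thesis by (simp only: sum_single_lookup)
qed

text \<open>
  By bilinearity it suffices to compare products of monomials, where the scalars can be moved to the
  front because they are central.
\<close>

lemma linear_extension_mult: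
  assumes hom: "\<And>a b. f (a + b) = f a * f b"
  shows "linear_extension f (x * y) = linear_extension f x * linear_extension f y"
proof -
  have single: "linear_extension f (Poly_Mapping.single k c * Poly_Mapping.single l d) =
      linear_extension f (Poly_Mapping.single k c) * linear_extension f (Poly_Mapping.single l d)" for k c l d
  proof -
    have "Poly_Mapping.single 0 (c * d) * (f k * f l) =
        Poly_Mapping.single 0 c * (Poly_Mapping.single 0 d * f k) * f l"
      by (simp add: mult.assoc[symmetric] mult_single)
    also have "\<dots> = Poly_Mapping.single 0 c * f k * (Poly_Mapping.single 0 d * f l)"
      by (simp only: single_zero_commute[of d] mult.assoc)
    finally show ?thesis by (simp add: mult_single hom)
  qed
  have "linear_extension f
      ((\<Sum>k\<in>Poly_Mapping.keys x. Poly_Mapping.single k (Poly_Mapping.lookup x k)) *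
       (\<Sum>l\<in>Poly_Mapping.keys y. Poly_Mapping.single l (Poly_Mapping.lookup y l))) =
      linear_extension f (\<Sum>k\<in>Poly_Mapping.keys x. Poly_Mapping.single k (Poly_Mapping.lookup x k)) *
      linear_extension f (\<Sum>l\<in>Poly_Mapping.keys y. Poly_Mapping.single l (Poly_Mapping.lookup y l))"
    unfolding sum_product linear_extension_sum single ..
  then show ?thesis by (simp only: sum_single_lookup)
qed

lemma ring_hom_linear_extension:
  assumes "\<And>a b. f (a + b) = f a * f b" "f 0 = 1"
  shows "ring_hom_ring ring_of_type_algebra ring_of_type_algebra (linear_extension f)"
proof (rule ring_hom_ringI2)
  have "linear_extension f 1 = 1"
    using linear_extension_single[of f 0 1] assms(2) by simp
  then show "linear_extension f \<in> ring_hom ring_of_type_algebra ring_of_type_algebra"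
    by (intro ring_hom_memI) (simp_all add: linear_extension_add linear_extension_mult[OF assms(1)])
qed (rule ring_ring_of_type_algebra)+

definition free_scale :: "'a::comm_ring_1 \<Rightarrow> ('k \<Rightarrow>\<^sub>0 'a) \<Rightarrow> ('k \<Rightarrow>\<^sub>0 'a)" where
  "free_scale c = Poly_Mapping.map ((*) c)"

lemma lookup_free_scale [simp]: "Poly_Mapping.lookup (free_scale c x) k = c * Poly_Mapping.lookup x k"
  by (simp add: free_scale_def map.rep_eq when_def)

lemma module_free_scale: "Modules.module free_scale"
  by unfold_locales (auto intro!: poly_mapping_eqI simp: lookup_add algebra_simps)

text \<open>
  A word in vectors of a free module, multiplied out in the basis.
\<close>

primrec expand_word :: "('k \<Rightarrow>\<^sub>0 'a::comm_ring_1) free_word \<Rightarrow> ('k free_word \<Rightarrow>\<^sub>0 'a)" where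
  "expand_word (Word xs) = prod_list (map (linear_extension letter) xs)"

lemma expand_word_add: "expand_word (u + w) = expand_word u * expand_word w"
  by (cases u; cases w) simp

lemma expand_word_zero: "expand_word 0 = 1"
  by (simp add: zero_free_word_def)

lemma expand_letter: "linear_extension expand_word (letter x) = linear_extension letter x"
  by (simp add: letter_def)

text \<open>
  The kernel of the expansion is an ideal, and it contains the generators of the tensor ideal because
  the expansion of a single letter is linear in the vector.
\<close>

lemma tensor_ideal_free_scale:
  fixes t :: "('k \<Rightarrow>\<^sub>0 'a::comm_ring_1) free_word \<Rightarrow>\<^sub>0 'a"
  assumes "t \<in> tensor_ideal free_scale"
  shows "linear_extension expand_word t = 0"
proof -
  let ?\<Phi> = "linear_extension expand_word :: (('k \<Rightarrow>\<^sub>0 'a) free_word \<Rightarrow>\<^sub>0 'a) \<Rightarrow> _"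
  have hom: "ring_hom_ring free_alg free_alg ?\<Phi>"
    using expand_word_add expand_word_zero by (rule ring_hom_linear_extension)
  have "tensor_ideal free_scale \<subseteq> a_kernel free_alg free_alg ?\<Phi>"
    unfolding tensor_ideal_def
  proof (rule ring.genideal_minimal[OF ring_ring_of_type_algebra ring_hom_ring.kernel_is_ideal[OF hom]], safe)
    fix x y :: "'k \<Rightarrow>\<^sub>0 'a" and c
    show "letter (x + y) - letter x - letter y \<in> a_kernel free_alg free_alg ?\<Phi>"
      by (simp add: a_kernel_def' linear_extension_diff expand_letter linear_extension_add)
    show "letter (free_scale c x) - scalar c * letter x \<in> a_kernel free_alg free_alg ?\<Phi>"
      by (simp add: a_kernel_def' linear_extension_diff expand_letter scalar_def expand_word_zero
          linear_extension_mult[OF expand_word_add] free_scale_def linear_extension_scale)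
  qed
  with assms show ?thesis by (auto simp: a_kernel_def')
qed

lemma expand_basis_word:
  fixes c :: "'a::comm_ring_1" and w :: "'k list"
  shows "linear_extension expand_word (word_term (map (\<lambda>k. Poly_Mapping.single k 1) w) c) = word_term w c"
proof -
  have "prod_list (map (letter :: 'k \<Rightarrow> 'k free_word \<Rightarrow>\<^sub>0 'a) w) = word_term w 1" for w :: "'k list"
    by (induction w) (simp_all add: one_eq_word_term letter_def word_term_mult flip: word_term_def)
  then show ?thesis
    by (simp add: word_term_def o_def mult_single)
qed

lemma expand_act_word:
  fixes x :: "(nat \<Rightarrow> nat) \<Rightarrow>\<^sub>0 'a::comm_ring_1"
  shows "linear_extension expand_word (act_word n x (\<lambda>i. Poly_Mapping.single i 1)) = act_word n x (\<lambda>i. i)"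
proof -
  have "linear_extension expand_word (word_term (map (\<lambda>i. Poly_Mapping.single (f i) 1) js) c) =
      word_term (map f js) c" for f :: "nat \<Rightarrow> nat" and js and c :: 'a
    using expand_basis_word[of "map f js" c] by (simp add: o_def)
  then show ?thesis
    unfolding act_word_def linear_extension_sum by simp
qed

text \<open>
  Distinct permutations give distinct words in the letters \<open>1, \<dots>, n\<close>, so the coefficient of \<open>x\<close> at
  \<open>\<tau>\<close> is the coefficient of a single word.
\<close>

lemma act_word_inject:
  fixes x y :: "(nat \<Rightarrow> nat) \<Rightarrow>\<^sub>0 'a::comm_ring_1"
  assumes "x \<in> sym_module n" "y \<in> sym_module n" "act_word n x (\<lambda>i. i) = act_word n y (\<lambda>i. i)"
  shows "x = y"
proof (rule poly_mapping_eqI)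
  fix \<tau>
  let ?w = "\<lambda>\<sigma>. map (inv_into UNIV \<sigma>) [1..<Suc n]"
  show "Poly_Mapping.lookup x \<tau> = Poly_Mapping.lookup y \<tau>"
  proof (cases "\<tau> permutes {1..n}")
    case False
    then have "\<tau> \<notin> Poly_Mapping.keys x" "\<tau> \<notin> Poly_Mapping.keys y"
      using assms(1,2) unfolding sym_module_def by blast+
    then show ?thesis by (simp add: in_keys_iff)
  next
    case True
    have inj: "\<sigma> = \<tau>" if \<sigma>: "\<sigma> permutes {1..n}" and eq: "?w \<sigma> = ?w \<tau>" for \<sigma>
    proof -
      have "inv_into UNIV \<sigma> i = inv_into UNIV \<tau> i" for i
      proof (cases "i \<in> {1..n}")
        case True
        then show ?thesis using eq by (auto simp: map_eq_conv)
      next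
        case False
        then show ?thesis
          using permutes_not_in[OF permutes_inv[OF \<sigma>]] permutes_not_in[OF permutes_inv[OF \<open>\<tau> permutes _\<close>]]
          by simp
      qed
      then have "inv_into UNIV \<sigma> = inv_into UNIV \<tau>" by blast
      then show ?thesis
        using permutes_inv_inv[OF \<sigma>] permutes_inv_inv[OF True] by metis
    qed
    have "Poly_Mapping.lookup (act_word n z (\<lambda>i. i)) (Word (?w \<tau>)) = Poly_Mapping.lookup z \<tau>"
      for z :: "(nat \<Rightarrow> nat) \<Rightarrow>\<^sub>0 'a"
    proof -
      have "Poly_Mapping.lookup (act_word n z (\<lambda>i. i)) (Word (?w \<tau>)) =
          (\<Sum>\<sigma> | \<sigma> permutes {1..n}. if \<sigma> = \<tau> then Poly_Mapping.lookup z \<sigma> else 0)"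
        unfolding act_word_def lookup_sum word_term_def lookup_single
        by (intro sum.cong refl) (use inj in \<open>auto simp: when_def\<close>)
      then show ?thesis using True by (simp add: finite_permutations)
    qed
    then show ?thesis using assms(3) by metis
  qed
qed

lemma is_theta_unique:
  fixes x y :: "(nat \<Rightarrow> nat) \<Rightarrow>\<^sub>0 'a::comm_ring_1"
  assumes "is_theta n x" "is_theta n y"
  shows "x = y"
proof (rule act_word_inject)
  show "x \<in> sym_module n" "y \<in> sym_module n"
    using assms by (auto simp: is_theta_def)
  let ?e = "\<lambda>i::nat. Poly_Mapping.single i (1::'a)"
  let ?s = "free_scale :: 'a \<Rightarrow> (nat \<Rightarrow>\<^sub>0 'a) \<Rightarrow> (nat \<Rightarrow>\<^sub>0 'a)"
  have "acts_as_left_bracket ?s n x" "acts_as_left_bracket ?s n y"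
    using assms module_free_scale by (auto simp: is_theta_def)
  then have "tensor_class ?s (act_word n x ?e) = tensor_class ?s (act_word n y ?e)"
    by (simp add: acts_as_left_bracket_def act_pure_eq)
  then have "linear_extension expand_word (act_word n x ?e - act_word n y ?e) = 0"
    by (intro tensor_ideal_free_scale tensor_class_eq_imp_diff_mem)
  then show "act_word n x (\<lambda>i. i) = act_word n y (\<lambda>i. i)"
    by (simp add: linear_extension_diff expand_act_word)
qed

section \<open>The Dynkin element in the M basis\<close>

theorem theorem5p3:
  fixes n :: nat
  assumes "n \<ge> 1"
  shows "(\<exists>!x :: (nat \<Rightarrow> nat) \<Rightarrow>\<^sub>0 'a::comm_ring_1. is_theta n x) \<and>
    (\<forall>scale :: 'a \<Rightarrow> 'v::ab_group_add \<Rightarrow> 'v.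
       Modules.module scale \<longrightarrow> acts_as_left_bracket scale n (theta n)) \<and>
    (theta n :: (nat \<Rightarrow> nat) \<Rightarrow>\<^sub>0 'a) =
      (\<Sum>\<sigma> | \<sigma> permutes {1..n} \<and> \<sigma> 1 = 1. M_basis n \<sigma>)"
proof -
  let ?d = "dynkin n :: (nat \<Rightarrow> nat) \<Rightarrow>\<^sub>0 'a"
  have d: "is_theta n ?d"
    by (simp add: is_theta_def dynkin_in_sym_module[OF assms] dynkin_acts[OF assms])
  then have ex1: "\<exists>!x :: (nat \<Rightarrow> nat) \<Rightarrow>\<^sub>0 'a. is_theta n x"
    using is_theta_unique by blast
  have theta: "theta n = ?d"
    unfolding theta_def using d is_theta_unique by (intro the_equality) auto
  have "?d = (\<Sum>\<sigma> | \<sigma> permutes {1..n} \<and> \<sigma> 1 = 1. M_basis n \<sigma>)"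
    by (rule M_basis_sum_unique[OF dynkin_in_sym_module[OF assms] sum_dynkin_below[OF assms]])
  moreover have "\<forall>scale :: 'a \<Rightarrow> 'v \<Rightarrow> 'v. Modules.module scale \<longrightarrow> acts_as_left_bracket scale n ?d"
    using dynkin_acts[OF assms] by blast
  ultimately show ?thesis
    using ex1 unfolding theta by blast
qed

end
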